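(* Let $\Gamma$ be a completed graph in $d=2\lambda+2>2$ dimensions whose graphical function $f^{(\lambda)}_\Gamma$ converges. For labels $a,b\in\{0,1,z,\infty\}$ let $\Gamma_{(ab)}$ denote $\Gamma$ with the labels $a$ and $b$ interchanged. Then, as functions of $z\in\mathbb{C}\setminus\{0,1\}$, $$f^{(\lambda)}_\Gamma(z)=f^{(\lambda)}_{\Gamma_{(0\infty)}}(1/z),\qquad f^{(\lambda)}_\Gamma(z)=f^{(\lambda)}_{\Gamma_{(01)}}(1-z),\qquad f^{(\lambda)}_\Gamma(z)=f^{(\lambda)}_{\Gamma_{(1z)}}(1/z).$$ Consequently, for every permutation $\sigma$ of $\{0,1,z,\infty\}$, $f^{(\lambda)}_\Gamma(z)=f^{(\lambda)}_{\sigma(\Gamma)}(\phi(\sigma)(z))$, where $\phi$ is the homomorphism to the group of Möbius transformations permuting $\{0,1,\infty\}$ determined by $\phi((0\infty))=\phi((1z))=(z\mapsto1/z)$ and $\phi((01))=(z\mapsto1-z)$.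
   Context: A completed graph $\Gamma$ in $d=2\lambda+2$ dimensions has labeled vertices $0,1,z,\infty$ and real edge weights $\nu_e$ such that each unlabeled vertex has weighted valency $2d/(d-2)$ and each labeled vertex weighted valency $0$. Its graphical function is $f^{(\lambda)}_\Gamma(z)=\Big(\prod_{v\notin\{0,1,z,\infty\}}\int_{\mathbb{R}^d}\frac{d^dx_v}{\pi^{d/2}}\Big)\prod_e\|x_e-y_e\|^{-2\lambda\nu_e}$, where edges incident to $\infty$ and the edge between $0$ and $1$ contribute the factor $1$, $0$ is the origin, $1$ a unit vector $e_1$. It depends only on $\|z\|$ and the angle with $e_1$ and is regarded as a function of complex $z$ (identifying $e_1$ with $1$); it satisfies $f(z)=f(\bar z)$. *)

theory Defs
  imports "HOL-Analysis.Analysis" "HOL-Combinatorics.Transposition"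
begin

datatype label = L0 | L1 | Lz | Linf

text \<open>A graph with (possibly multiple) undirected edges; each edge e joins
  src e and tgt e (orientation irrelevant) and carries a real weight wt e.
  lab assigns to each label its labelled vertex.\<close>
record ('v, 'e) cgraph =
  verts :: "'v set"
  edges :: "'e set"
  src   :: "'e \<Rightarrow> 'v"
  tgt   :: "'e \<Rightarrow> 'v"
  wt    :: "'e \<Rightarrow> real"
  lab   :: "label \<Rightarrow> 'v"

definition incident :: "('v, 'e) cgraph \<Rightarrow> 'v \<Rightarrow> 'e \<Rightarrow> bool" where
  "incident G v e \<longleftrightarrow> src G e = v \<or> tgt G e = v"

definition wvalency :: "('v, 'e) cgraph \<Rightarrow> 'v \<Rightarrow> real" where
  "wvalency G v = (\<Sum>e\<in>{e\<in>edges G. incident G v e}. wt G e)"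

definition internal_verts :: "('v, 'e) cgraph \<Rightarrow> 'v set" where
  "internal_verts G = verts G - range (lab G)"

definition completed :: "nat \<Rightarrow> ('v, 'e) cgraph \<Rightarrow> bool" where
  "completed d G \<longleftrightarrow>
     finite (verts G) \<and> finite (edges G) \<and>
     (\<forall>e\<in>edges G. src G e \<in> verts G \<and> tgt G e \<in> verts G \<and> src G e \<noteq> tgt G e) \<and>
     inj (lab G) \<and> range (lab G) \<subseteq> verts G \<and>
     (\<forall>v\<in>internal_verts G. wvalency G v = 2 * real d / (real d - 2)) \<and>
     (\<forall>a. wvalency G (lab G a) = 0)"

text \<open>Relabelling by a permutation sigma of the labels: the vertex that carried
  label a now carries label sigma a.\<close>
definition relabel :: "(label \<Rightarrow> label) \<Rightarrow> ('v, 'e) cgraph \<Rightarrow> ('v, 'e) cgraph" where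
  "relabel \<sigma> G = G\<lparr>lab := lab G \<circ> inv \<sigma>\<rparr>"

text \<open>Two orthonormal basis vectors; e1 plays the role of the point 1,
  and complex z is identified with Re z e1 + Im z e2.\<close>
definition bvec1 :: "'a::euclidean_space" where
  "bvec1 = (SOME b. b \<in> Basis)"

definition bvec2 :: "'a::euclidean_space" where
  "bvec2 = (SOME b. b \<in> Basis \<and> b \<noteq> bvec1)"

definition cemb :: "complex \<Rightarrow> 'a::euclidean_space" where
  "cemb z = Re z *\<^sub>R bvec1 + Im z *\<^sub>R bvec2"

definition vpos :: "('v, 'e) cgraph \<Rightarrow> complex \<Rightarrow> ('v \<Rightarrow> 'a::euclidean_space) \<Rightarrow> 'v \<Rightarrow> 'a" where
  "vpos G z x v =
     (if v = lab G L0 then 0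
      else if v = lab G L1 then bvec1
      else if v = lab G Lz then cemb z
      else x v)"

definition glambda :: "'a::euclidean_space itself \<Rightarrow> real" where
  "glambda T = (real DIM('a) - 2) / 2"

definition edge_factor :: "('v, 'e) cgraph \<Rightarrow> complex \<Rightarrow> ('v \<Rightarrow> 'a::euclidean_space) \<Rightarrow> 'e \<Rightarrow> real" where
  "edge_factor G z x e =
     (if incident G (lab G Linf) e \<or>
         {src G e, tgt G e} = {lab G L0, lab G L1} then 1
      else norm (vpos G z x (src G e) - vpos G z x (tgt G e))
             powr (- 2 * glambda TYPE('a) * wt G e))"

definition gintegrand :: "('v, 'e) cgraph \<Rightarrow> complex \<Rightarrow> ('v \<Rightarrow> 'a::euclidean_space) \<Rightarrow> real" where
  "gintegrand G z x = (\<Prod>e\<in>edges G. edge_factor G z x e)"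

definition gmeasure :: "'a::euclidean_space itself \<Rightarrow> ('v, 'e) cgraph \<Rightarrow> ('v \<Rightarrow> 'a) measure" where
  "gmeasure T G = PiM (internal_verts G) (\<lambda>_. (lborel :: 'a measure))"

text \<open>Graphical function, with measure d^dx / pi^(d/2) per internal vertex.\<close>
definition graphical_function :: "'a::euclidean_space itself \<Rightarrow> ('v, 'e) cgraph \<Rightarrow> complex \<Rightarrow> real" where
  "graphical_function T G z =
     (1 / pi powr (real DIM('a) / 2)) ^ card (internal_verts G) *
     integral\<^sup>L (gmeasure T G) (gintegrand G z :: ('v \<Rightarrow> 'a) \<Rightarrow> real)"

definition gf_converges :: "'a::euclidean_space itself \<Rightarrow> ('v, 'e) cgraph \<Rightarrow> bool" where
  "gf_converges T G \<longleftrightarrow>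
     (\<forall>z. z \<noteq> 0 \<and> z \<noteq> 1 \<longrightarrow>
        integrable (gmeasure T G) (gintegrand G z :: ('v \<Rightarrow> 'a) \<Rightarrow> real))"

end

theory Submission
  imports Defs "HOL-Combinatorics.Permutations"
begin

text \<open>
  Each generating transposition is realised by a conformal substitution of the integration variables
  that moves the labelled points to their new places: \<open>x \<mapsto> 1 - x\<close>, the multiplication by \<open>1 / z\<close> in
  the plane of the labels, and the sphere inversion composed with a reflection. Every such map changes
  distances by \<open>|Jx - Jy| = |x - y| / (a x * a y)\<close> for a function \<open>a\<close> on the points, whose Jacobian is
  then \<open>a x powr (-2d)\<close>. In the product over the edges, each vertex \<open>v\<close> collects the power
  \<open>(d - 2) * valency v\<close> of \<open>a\<close>: this is \<open>2d\<close> for an internal vertex, cancelling the Jacobian, and \<open>0\<close> for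
  a labelled one. The vertex at infinity is treated like the others, with distance \<open>1\<close> to all vertices.
\<close>

section \<open>Conformal change of variables for Lebesgue measure\<close>

text \<open>The library's change of variables is only stated for \<open>real ^ 'n\<close> with a well-ordered index type, so
  an abstract Euclidean space is transferred to \<open>real ^ 'a basis_index\<close>.\<close>
typedef (overloaded) ('a::euclidean_space) basis_index = "Basis :: 'a set"
  morphisms basis_of_index index_of_basis
  using nonempty_Basis by blast

instance basis_index :: (euclidean_space) finite
proof
  have "range basis_of_index = (Basis :: 'a set)"
    by (rule type_definition.Rep_range[OF type_definition_basis_index])
  then show "finite (UNIV :: 'a basis_index set)"
    by (metis basis_of_index_inject finite_Basis finite_imageD injI)
qed

text \<open>An arbitrary numbering of the basis, from which the index type obtains its
  well-order.\<close>

definition basis_rank :: "'a::euclidean_space basis_index \<Rightarrow> nat" where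
  "basis_rank = (SOME f. inj f)"

lemma inj_basis_rank: "inj (basis_rank :: 'a::euclidean_space basis_index \<Rightarrow> nat)"
proof -
  have "\<exists>f :: 'a basis_index \<Rightarrow> nat. inj f"
    using finite_imp_inj_to_nat_seg[of "UNIV :: 'a basis_index set"] by auto
  then show ?thesis
    unfolding basis_rank_def by (rule someI_ex)
qed

instantiation basis_index :: (euclidean_space) wellorder
begin

definition less_eq_basis_index :: "'a basis_index \<Rightarrow> 'a basis_index \<Rightarrow> bool" where
  "less_eq_basis_index i j \<longleftrightarrow> basis_rank i \<le> basis_rank j"

definition less_basis_index :: "'a basis_index \<Rightarrow> 'a basis_index \<Rightarrow> bool" where
  "less_basis_index i j \<longleftrightarrow> basis_rank i < basis_rank j"

instance
proof
  fix P :: "'a basis_index \<Rightarrow> bool" and a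
  assume "\<And>x. (\<And>y. y < x \<Longrightarrow> P y) \<Longrightarrow> P x"
  then show "P a"
    unfolding less_basis_index_def by (induction a rule: measure_induct_rule[of basis_rank]) blast
qed (auto simp: less_eq_basis_index_def less_basis_index_def dest: injD[OF inj_basis_rank])

end

lemma bij_betw_basis_of_index: "bij_betw basis_of_index UNIV (Basis :: 'a::euclidean_space set)"
  by (metis basis_of_index_inject bij_betw_def injI type_definition.Rep_range type_definition_basis_index)

lemma basis_of_index_in_Basis [simp]: "basis_of_index i \<in> Basis"
  by (rule basis_of_index)

lemma CARD_basis_index: "CARD('a::euclidean_space basis_index) = DIM('a)"
  using bij_betw_basis_of_index bij_betw_same_card by blast

definition coords :: "'a::euclidean_space \<Rightarrow> real ^ 'a basis_index" where
  "coords x = (\<chi> i. x \<bullet> basis_of_index i)"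

definition uncoords :: "real ^ 'a basis_index \<Rightarrow> 'a::euclidean_space" where
  "uncoords v = (\<Sum>i\<in>UNIV. v $ i *\<^sub>R basis_of_index i)"

lemma inner_uncoords_basis: "uncoords v \<bullet> basis_of_index i = v $ i"
proof -
  have "uncoords v \<bullet> basis_of_index i = (\<Sum>j\<in>UNIV. v $ j * (basis_of_index j \<bullet> basis_of_index i))"
    by (simp add: uncoords_def inner_sum_left)
  also have "\<dots> = (\<Sum>j\<in>UNIV. if j = i then v $ j else 0)"
    by (intro sum.cong) (auto simp: inner_Basis basis_of_index_inject)
  finally show ?thesis by simp
qed

lemma coords_uncoords [simp]: "coords (uncoords v) = v"
  by (simp add: coords_def inner_uncoords_basis vec_eq_iff)

lemma uncoords_coords [simp]: "uncoords (coords x) = (x :: 'a::euclidean_space)"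
proof -
  have "uncoords (coords x) = (\<Sum>b\<in>Basis. (x \<bullet> b) *\<^sub>R b)"
    unfolding uncoords_def coords_def
    using sum.reindex_bij_betw[OF bij_betw_basis_of_index, of "\<lambda>b. (x \<bullet> b) *\<^sub>R b"] by simp
  then show ?thesis by (simp add: euclidean_representation)
qed

lemma linear_coords: "linear coords"
  by (rule linearI) (auto simp: coords_def vec_eq_iff inner_add_left)

lemma linear_uncoords: "linear uncoords"
  by (rule linearI) (auto simp: uncoords_def scaleR_add_left sum.distrib scaleR_sum_right)

lemma norm_coords [simp]: "norm (coords x) = norm (x :: 'a::euclidean_space)"
proof -
  have "coords x \<bullet> coords x = (\<Sum>b\<in>Basis. (x \<bullet> b) * (x \<bullet> b))"
    unfolding inner_vec_def coords_def
    using sum.reindex_bij_betw[OF bij_betw_basis_of_index, of "\<lambda>b. (x \<bullet> b) * (x \<bullet> b)"] by simp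
  also have "\<dots> = x \<bullet> x" by (simp add: euclidean_inner[of x x])
  finally show ?thesis by (simp add: norm_eq_sqrt_inner)
qed

lemma norm_uncoords [simp]: "norm (uncoords v) = norm v"
  using norm_coords[of "uncoords v"] by simp

text \<open>Lebesgue measure is determined by its values on boxes. Since \<open>uncoords\<close>
  only renames coordinates, the preimage of a box is a box with the same side lengths.\<close>

lemma distr_lborel_uncoords:
  "distr lborel borel (uncoords :: real ^ 'a basis_index \<Rightarrow> 'a::euclidean_space) = lborel"
proof (rule lborel_eqI[symmetric])
  fix l u :: 'a
  assume lu: "\<And>b. b \<in> Basis \<Longrightarrow> l \<bullet> b \<le> u \<bullet> b"
  have [measurable]: "uncoords \<in> borel_measurable borel"
    by (intro borel_measurable_continuous_onI linear_continuous_on linear_conv_bounded_linear[THEN iffD1] linear_uncoords)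
  have "uncoords -` box l u = box (coords l) (coords u)"
  proof (intro set_eqI)
    fix v :: "real ^ 'a basis_index"
    have "v \<in> uncoords -` box l u \<longleftrightarrow> (\<forall>b\<in>range basis_of_index. l \<bullet> b < uncoords v \<bullet> b \<and> uncoords v \<bullet> b < u \<bullet> b)"
      using bij_betw_basis_of_index[where 'a='a] by (auto simp: mem_box bij_betw_def)
    also have "\<dots> \<longleftrightarrow> v \<in> box (coords l) (coords u)"
      by (simp add: inner_uncoords_basis mem_box_cart coords_def)
    finally show "v \<in> uncoords -` box l u \<longleftrightarrow> v \<in> box (coords l) (coords u)" .
  qed
  then have "emeasure (distr lborel borel uncoords) (box l u) = emeasure lborel (box (coords l) (coords u))"
    by (simp add: emeasure_distr)
  also have "\<dots> = (\<Prod>b\<in>Basis. (coords u - coords l) \<bullet> b)"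
    using lu by (intro emeasure_lborel_box) (auto simp: Basis_vec_def inner_axis coords_def)
  also have "(\<Prod>b\<in>Basis. (coords u - coords l) \<bullet> b) = (\<Prod>i\<in>UNIV. (u - l) \<bullet> basis_of_index i)"
  proof -
    have B: "(Basis :: (real ^ 'a basis_index) set) = range (\<lambda>i. axis i 1)"
      by (auto simp: Basis_vec_def)
    have "inj (\<lambda>i::'a basis_index. axis i (1::real))"
      by (auto simp: inj_on_def axis_eq_axis)
    then show ?thesis
      unfolding B by (subst prod.reindex) (auto simp: inner_axis coords_def inner_diff_left)
  qed
  also have "\<dots> = (\<Prod>b\<in>Basis. (u - l) \<bullet> b)"
    using prod.reindex_bij_betw[OF bij_betw_basis_of_index, of "\<lambda>b. (u - l) \<bullet> b"] .
  finally show "emeasure (distr lborel borel uncoords) (box l u) = (\<Prod>b\<in>Basis. (u - l) \<bullet> b)" .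
qed simp

section \<open>Maps with conformal derivative\<close>

text \<open>Dividing \<open>f\<close> by \<open>k\<close> gives an orthogonal map, of determinant 1
  or -1; the scaling by \<open>k\<close> contributes one factor \<open>k\<close> per
  dimension.\<close>

lemma abs_det_conformal:
  fixes f :: "real^'n \<Rightarrow> real^'n"
  assumes "linear f" "\<And>h. norm (f h) = k * norm h" "k > 0"
  shows "\<bar>det (matrix f)\<bar> = k ^ CARD('n)"
proof -
  define g where "g = (\<lambda>h. (1 / k) *\<^sub>R f h)"
  have lg: "linear g"
    unfolding g_def using assms(1) by (rule linear_compose_scale_right)
  have "orthogonal_transformation g"
    unfolding orthogonal_transformation using lg assms by (simp add: g_def)
  then have "det (matrix g) = 1 \<or> det (matrix g) = -1"
    using det_orthogonal_matrix orthogonal_transformation_matrix by blast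
  moreover have "f = (\<lambda>x. k *\<^sub>R x) \<circ> g"
    using assms(3) by (auto simp: g_def)
  then have "matrix f = matrix (\<lambda>x::real^'n. k *\<^sub>R x) ** matrix g"
    using lg by (metis linear_scale_self matrix_compose)
  ultimately show ?thesis
    using assms(3) by (auto simp: det_mul abs_mult)
qed

text \<open>Again it suffices to test on boxes. The measure of the image of a set under an injective
  differentiable map is the integral of the absolute Jacobian determinant, which for a conformal
  derivative is a power of \<open>k\<close>. The set \<open>U\<close> leaves room for a null set of
  singular points, such as the centre of an inversion.\<close>

lemma distr_lborel_conformal_cart:
  fixes J :: "real^'n::{finite,wellorder} \<Rightarrow> real^'n::_"
  assumes [measurable]: "J \<in> borel_measurable borel" "k \<in> borel_measurable borel"
    and U: "U \<in> sets borel" "- U \<in> null_sets lborel"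
    and der: "\<And>x. x \<in> U \<Longrightarrow> (J has_derivative J' x) (at x)"
    and conf: "\<And>x h. x \<in> U \<Longrightarrow> norm (J' x h) = k x * norm h"
    and kpos: "\<And>x. x \<in> U \<Longrightarrow> k x > 0"
    and inj: "inj_on J U"
    and im: "- (J ` U) \<in> null_sets lborel"
  shows "distr (density lborel (\<lambda>x. ennreal (k x ^ CARD('n)))) borel J = lborel"
proof (rule lborel_eqI[symmetric])
  fix l u :: "real^'n::_"
  assume lu: "\<And>b. b \<in> Basis \<Longrightarrow> l \<bullet> b \<le> u \<bullet> b"
  note U(1)[measurable]
  define S where "S = U \<inter> J -` box l u"
  have S[measurable]: "S \<in> sets borel"
  proof -
    have "J -` box l u \<inter> space borel \<in> sets borel"
      by (rule measurable_sets[OF assms(1)]) simp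
    then show ?thesis unfolding S_def using U(1) by auto
  qed
  define m where "m = measure lebesgue (box l u)"
  \<comment> \<open>The image of \<open>S\<close> fills the box except for points that
    \<open>J\<close> does not reach from \<open>U\<close>, and these form a null set by
    \<open>im\<close>.\<close>
  have JS: "J ` S = box l u - (box l u - J ` U)"
    unfolding S_def by auto
  have N: "box l u - J ` U \<in> null_sets lebesgue"
    by (rule null_sets_completion_subset[OF _ null_sets_completionI[OF im]]) auto
  have 1: "J ` S \<in> lmeasurable \<and> measure lebesgue (J ` S) = m"
    unfolding JS m_def
    by (intro conjI fmeasurable_Diff measure_Diff_null_set lmeasurable_box fmeasurableD[OF lmeasurable_box]
        null_setsD2[OF N] N)
  have "((\<lambda>x. \<bar>det (matrix (J' x))\<bar>) has_integral m) S"
  proof (subst has_measure_differentiable_image[symmetric])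
    show "S \<in> sets lebesgue" using S by simp
    show "(J has_derivative J' x) (at x within S)" if "x \<in> S" for x
      using der that has_derivative_at_withinI unfolding S_def by blast
    show "inj_on J S" using inj unfolding S_def by (auto intro: inj_on_subset)
  qed (rule 1)
  then have "((\<lambda>x. k x ^ CARD('n)) has_integral m) S"
  proof (rule has_integral_eq[rotated])
    show "\<bar>det (matrix (J' x))\<bar> = k x ^ CARD('n)" if "x \<in> S" for x
      using that der conf kpos unfolding S_def
      by (intro abs_det_conformal) (auto dest: has_derivative_linear)
  qed
  then have "(\<integral>\<^sup>+x. ennreal (k x ^ CARD('n)) * indicator S x \<partial>lborel) = ennreal m"
    using kpos
    by (intro nn_integral_has_integral_lebesgue')
       (auto simp: S_def less_imp_le zero_le_power)
  moreover have "emeasure (distr (density lborel (\<lambda>x. ennreal (k x ^ CARD('n)))) borel J) (box l u)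
     = (\<integral>\<^sup>+x. ennreal (k x ^ CARD('n)) * indicator S x \<partial>lborel)"
  proof -
    \<comment> \<open>The complement of \<open>U\<close> is a null set, so the full preimage of the
      box may be cut down to \<open>S\<close>.\<close>
    have "AE x in lborel. x \<in> U"
      using U(2) by (intro AE_I'[where N="-U"]) auto
    have "emeasure (distr (density lborel (\<lambda>x. ennreal (k x ^ CARD('n)))) borel J) (box l u)
      = (\<integral>\<^sup>+x. ennreal (k x ^ CARD('n)) * indicator (J -` box l u) x \<partial>lborel)"
      using measurable_sets[OF assms(1), of "box l u"]
      by (subst emeasure_distr) (auto simp: emeasure_density)
    also have "\<dots> = (\<integral>\<^sup>+x. ennreal (k x ^ CARD('n)) * indicator S x \<partial>lborel)"
      using \<open>AE x in lborel. x \<in> U\<close>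
      by (intro nn_integral_cong_AE) (auto simp: S_def indicator_def elim!: eventually_mono)
    finally show ?thesis .
  qed
  moreover have "ennreal m = (\<Prod>b\<in>Basis. (u - l) \<bullet> b)"
    unfolding m_def using lu by (simp add: measure_completion measure_lborel_box_eq)
  ultimately show "emeasure (distr (density lborel (\<lambda>x. ennreal (k x ^ CARD('n)))) borel J) (box l u)
     = (\<Prod>b\<in>Basis. (u - l) \<bullet> b)" by simp
qed simp

text \<open>Conjugation by the isometry \<open>coords\<close> turns \<open>J\<close> into a map
  \<open>K\<close> of the Cartesian space with the same conformal factor; the result for
  \<open>K\<close> is carried back along \<open>uncoords\<close>, which preserves Lebesgue
  measure.\<close>

lemma distr_lborel_conformal:
  fixes J :: "'a::euclidean_space \<Rightarrow> 'a"
  assumes [measurable]: "J \<in> borel_measurable borel" "k \<in> borel_measurable borel"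
    and U: "U \<in> sets borel" "- U \<in> null_sets lborel"
    and der: "\<And>x. x \<in> U \<Longrightarrow> (J has_derivative J' x) (at x)"
    and conf: "\<And>x h. x \<in> U \<Longrightarrow> norm (J' x h) = k x * norm h"
    and kpos: "\<And>x. x \<in> U \<Longrightarrow> k x > 0"
    and inj: "inj_on J U"
    and im: "- (J ` U) \<in> null_sets lborel"
  shows "distr (density lborel (\<lambda>x. ennreal (k x ^ DIM('a)))) borel J = lborel"
proof -
  have bl: "bounded_linear (coords :: 'a \<Rightarrow> _)" "bounded_linear (uncoords :: _ \<Rightarrow> 'a)"
    using linear_coords linear_uncoords linear_conv_bounded_linear by blast+
  have [measurable]: "(coords :: 'a \<Rightarrow> _) \<in> borel_measurable borel" "(uncoords :: _ \<Rightarrow> 'a) \<in> borel_measurable borel"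
    by (auto intro!: borel_measurable_continuous_onI linear_continuous_on bl)
  define K where "K = (\<lambda>v. coords (J (uncoords v)))"
  have null: "uncoords -` N \<in> null_sets lborel" if "N \<in> null_sets (lborel :: 'a measure)" for N
  proof -
    have "N \<in> null_sets (distr lborel borel uncoords)"
      using that by (simp add: distr_lborel_uncoords)
    then show ?thesis by (simp add: null_sets_distr_iff)
  qed
  have *: "distr (density lborel (\<lambda>v. ennreal (k (uncoords v) ^ CARD('a basis_index)))) borel K = lborel"
  proof (rule distr_lborel_conformal_cart[where U="uncoords -` U" and J'="\<lambda>v h. coords (J' (uncoords v) (uncoords h))"])
    show "uncoords -` U \<in> sets borel"
      using measurable_sets[of uncoords borel borel U] U by simp
    show "- (uncoords -` U) \<in> null_sets lborel"
      using null[OF U(2)] by (simp add: vimage_Compl)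
    show "(K has_derivative (\<lambda>h. coords (J' (uncoords v) (uncoords h)))) (at v)"
      if "v \<in> uncoords -` U" for v
    proof -
      have "(J \<circ> uncoords has_derivative (J' (uncoords v) \<circ> uncoords)) (at v)"
        using der that
        by (intro diff_chain_at[of uncoords uncoords] bounded_linear_imp_has_derivative bl) auto
      then have "(coords \<circ> (J \<circ> uncoords) has_derivative coords \<circ> (J' (uncoords v) \<circ> uncoords)) (at v)"
        by (rule diff_chain_at) (intro bounded_linear_imp_has_derivative bl)
      then show ?thesis unfolding K_def o_def .
    qed
    show "inj_on K (uncoords -` U)"
      unfolding K_def using inj
      by (intro inj_onI) (metis coords_uncoords inj_onD uncoords_coords vimageE)
    have "K ` (uncoords -` U) = uncoords -` (J ` U)"
    proof (intro set_eqI iffI)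
      fix v assume "v \<in> uncoords -` (J ` U)"
      then obtain x where x: "uncoords v = J x" "x \<in> U" by auto
      then have "v = K (coords x)"
        unfolding K_def by (metis coords_uncoords uncoords_coords)
      with x show "v \<in> K ` (uncoords -` U)"
        by (intro image_eqI[of _ _ "coords x"]) auto
    qed (auto simp: K_def)
    then show "- (K ` (uncoords -` U)) \<in> null_sets lborel"
      using null[OF im] by (simp add: vimage_Compl)
  qed (use conf kpos in \<open>auto simp: K_def\<close>)
  have "density lborel (\<lambda>x. ennreal (k x ^ DIM('a))) =
     density (distr lborel borel uncoords) (\<lambda>x. ennreal (k x ^ DIM('a)))"
    by (simp add: distr_lborel_uncoords)
  also have "\<dots> = distr (density lborel (\<lambda>v. ennreal (k (uncoords v) ^ DIM('a)))) borel uncoords"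
    by (subst density_distr) auto
  finally have "distr (density lborel (\<lambda>x. ennreal (k x ^ DIM('a)))) borel J
      = distr (density lborel (\<lambda>v. ennreal (k (uncoords v) ^ DIM('a)))) borel (J \<circ> uncoords)"
    by (simp add: distr_distr)
  also have "J \<circ> uncoords = uncoords \<circ> K"
    by (auto simp: K_def)
  also have "distr (density lborel (\<lambda>v. ennreal (k (uncoords v) ^ DIM('a)))) borel (uncoords \<circ> K)
    = distr (distr (density lborel (\<lambda>v. ennreal (k (uncoords v) ^ DIM('a)))) borel K) borel uncoords"
    by (subst distr_distr) (auto simp: K_def)
  also have "\<dots> = lborel"
    using * by (simp add: CARD_basis_index distr_lborel_uncoords)
  finally show ?thesis .
qed

section \<open>The same substitution in every integration variable\<close>

text \<open>The weighted image of the product measure is compared with the product measure on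
  rectangles. There both the weight and the indicator factor over the coordinates, so the integral
  splits into one-variable integrals, to which \<open>distr\<close> applies.\<close>

lemma integral_PiM_change_of_variables:
  fixes J :: "'a::euclidean_space \<Rightarrow> 'a" and F :: "('v \<Rightarrow> 'a) \<Rightarrow> real"
  assumes I: "finite I"
    and [measurable]: "J \<in> borel_measurable borel" "w \<in> borel_measurable borel"
    and w: "\<And>x. w x \<ge> 0"
    and distr: "distr (density lborel (\<lambda>x. ennreal (w x))) borel J = lborel"
    and F: "F \<in> borel_measurable (PiM I (\<lambda>_. lborel))"
  shows "(\<integral>y. F y \<partial>PiM I (\<lambda>_. lborel)) =
    (\<integral>x. (\<Prod>i\<in>I. w (x i)) * F (\<lambda>i\<in>I. J (x i)) \<partial>PiM I (\<lambda>_. lborel))"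
proof -
  interpret P: product_sigma_finite "\<lambda>_::'v. lborel :: 'a measure"
    by standard
  let ?P = "PiM I (\<lambda>_::'v. lborel :: 'a measure)"
  let ?J = "\<lambda>x. \<lambda>i\<in>I. J (x i)"
  have [measurable]: "?J \<in> ?P \<rightarrow>\<^sub>M ?P" by measurable
  have [measurable]: "(\<lambda>x. \<Prod>i\<in>I. w (x i)) \<in> borel_measurable ?P" by measurable
  have "distr (density ?P (\<lambda>x. ennreal (\<Prod>i\<in>I. w (x i)))) ?P ?J = ?P"
  proof (rule P.PiM_eqI)
    fix A :: "'v \<Rightarrow> 'a set" assume A: "\<And>i. i \<in> I \<Longrightarrow> A i \<in> sets lborel"
    have AE: "Pi\<^sub>E I A \<in> sets ?P" using A I by (intro sets_PiM_I_finite) auto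
    have pre: "J -` A i \<in> sets borel" if "i \<in> I" for i
      using measurable_sets[of J borel borel "A i"] A that by auto
    have "emeasure (distr (density ?P (\<lambda>x. ennreal (\<Prod>i\<in>I. w (x i)))) ?P ?J) (Pi\<^sub>E I A)
      = (\<integral>\<^sup>+x. ennreal (\<Prod>i\<in>I. w (x i)) * indicator (?J -` Pi\<^sub>E I A \<inter> space ?P) x \<partial>?P)"
      using AE by (subst emeasure_distr) (auto intro!: emeasure_density simp: measurable_sets)
    also have "\<dots> = (\<integral>\<^sup>+x. (\<Prod>i\<in>I. ennreal (w (x i)) * indicator (J -` A i) (x i)) \<partial>?P)"
    proof (intro nn_integral_cong)
      fix x assume "x \<in> space ?P"
      \<comment> \<open>If one coordinate leaves its \<open>A i\<close>, a factor on the right is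
        zero and both sides vanish; otherwise all factors are 1.\<close>
      then have "indicator (?J -` Pi\<^sub>E I A \<inter> space ?P) x = (\<Prod>i\<in>I. indicator (J -` A i) (x i) :: ennreal)"
        using I by (auto simp: indicator_def PiE_iff intro!: prod.neutral[symmetric] prod_zero[symmetric])
      then show "ennreal (\<Prod>i\<in>I. w (x i)) * indicator (?J -` Pi\<^sub>E I A \<inter> space ?P) x
          = (\<Prod>i\<in>I. ennreal (w (x i)) * indicator (J -` A i) (x i))"
        using w by (simp add: prod.distrib prod_ennreal)
    qed
    also have "\<dots> = (\<Prod>i\<in>I. \<integral>\<^sup>+x. ennreal (w x) * indicator (J -` A i) x \<partial>lborel)"
      using pre I by (intro P.product_nn_integral_prod) auto
    also have "\<dots> = (\<Prod>i\<in>I. emeasure (distr (density lborel (\<lambda>x. ennreal (w x))) borel J) (A i))"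
      using A pre by (intro prod.cong refl, subst emeasure_distr) (auto simp: emeasure_density)
    finally show "emeasure (distr (density ?P (\<lambda>x. ennreal (\<Prod>i\<in>I. w (x i)))) ?P ?J) (Pi\<^sub>E I A)
      = (\<Prod>i\<in>I. emeasure lborel (A i))"
      by (simp add: distr)
  qed (use I in auto)
  then have "(\<integral>y. F y \<partial>?P) = (\<integral>y. F y \<partial>distr (density ?P (\<lambda>x. ennreal (\<Prod>i\<in>I. w (x i)))) ?P ?J)"
    by simp
  also have "\<dots> = (\<integral>x. F (?J x) \<partial>density ?P (\<lambda>x. ennreal (\<Prod>i\<in>I. w (x i))))"
    using F by (subst integral_distr) auto
  also have "\<dots> = (\<integral>x. (\<Prod>i\<in>I. w (x i)) * F (?J x) \<partial>?P)"
    using F w by (subst integral_density) (auto intro!: prod_nonneg)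
  finally show ?thesis .
qed

section \<open>Graphs and distances\<close>

lemma completedD:
  assumes "completed d G"
  shows "finite (verts G)" "finite (edges G)" "inj (lab G)" "lab G a \<in> verts G"
    and "e \<in> edges G \<Longrightarrow> src G e \<in> verts G" "e \<in> edges G \<Longrightarrow> tgt G e \<in> verts G"
    and "e \<in> edges G \<Longrightarrow> src G e \<noteq> tgt G e"
    and "v \<in> internal_verts G \<Longrightarrow> wvalency G v = 2 * real d / (real d - 2)"
    and "wvalency G (lab G a) = 0"
  using assms unfolding completed_def by auto

lemma lab_eq_iff [simp]: "completed d G \<Longrightarrow> lab G a = lab G b \<longleftrightarrow> a = b"
  by (meson completedD(3) inj_eq)

lemma finite_internal_verts: "completed d G \<Longrightarrow> finite (internal_verts G)"
  unfolding internal_verts_def completed_def by auto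

lemma lab_notin_internal [simp]: "lab G a \<notin> internal_verts G"
  unfolding internal_verts_def by auto

lemma verts_cases:
  assumes "v \<in> verts G"
  obtains (internal) "v \<in> internal_verts G" | (labelled) a where "v = lab G a"
  using assms unfolding internal_verts_def by auto

lemma relabel_simps [simp]:
  "verts (relabel \<sigma> G) = verts G" "edges (relabel \<sigma> G) = edges G"
  "src (relabel \<sigma> G) = src G" "tgt (relabel \<sigma> G) = tgt G" "wt (relabel \<sigma> G) = wt G"
  "incident (relabel \<sigma> G) = incident G" "wvalency (relabel \<sigma> G) = wvalency G"
  by (auto simp: relabel_def incident_def[abs_def] wvalency_def[abs_def])

lemma lab_relabel: "bij \<sigma> \<Longrightarrow> lab (relabel \<sigma> G) (\<sigma> a) = lab G a"
  by (simp add: relabel_def bij_is_inj)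

lemma range_lab_relabel: "bij \<sigma> \<Longrightarrow> range (lab (relabel \<sigma> G)) = range (lab G)"
  by (simp add: relabel_def image_image[symmetric] bij_imp_bij_inv bij_is_surj del: image_image)

lemma internal_verts_relabel [simp]: "bij \<sigma> \<Longrightarrow> internal_verts (relabel \<sigma> G) = internal_verts G"
  by (simp add: internal_verts_def range_lab_relabel)

lemma completed_relabel:
  assumes "completed d G" "bij \<sigma>" shows "completed d (relabel \<sigma> G)"
proof -
  have "inj (lab (relabel \<sigma> G))"
    using assms unfolding relabel_def completed_def
    by (auto intro: inj_compose bij_is_inj bij_imp_bij_inv)
  moreover have "lab (relabel \<sigma> G) a \<in> verts G" "wvalency G (lab (relabel \<sigma> G) a) = 0" for a
    using assms(1) by (simp_all add: relabel_def completedD)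
  ultimately show ?thesis
    using assms unfolding completed_def by auto
qed

text \<open>Precomposing the labelling with the inverse permutation makes relabelling a left action,
  matching the order in which the homomorphism composes the Moebius maps.\<close>

lemma relabel_comp:
  assumes "bij \<sigma>" "bij \<tau>" shows "relabel (\<sigma> \<circ> \<tau>) G = relabel \<sigma> (relabel \<tau> G)"
  using assms by (simp add: relabel_def o_inv_distrib comp_assoc)

section \<open>Positions of the labelled points and distances between vertices\<close>

lemma bvec1_in_Basis [simp]: "(bvec1 :: 'a::euclidean_space) \<in> Basis"
  unfolding bvec1_def using nonempty_Basis by (simp add: some_in_eq)

lemma bvec2_in_Basis:
  assumes "DIM('a::euclidean_space) > 2"
  shows "(bvec2 :: 'a) \<in> Basis" "(bvec2 :: 'a) \<noteq> bvec1"
proof -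
  have "\<not> (Basis :: 'a set) \<subseteq> {bvec1}"
  proof
    assume "(Basis :: 'a set) \<subseteq> {bvec1}"
    then have "DIM('a) \<le> card {bvec1 :: 'a}" by (intro card_mono) auto
    then show False using assms by simp
  qed
  then have "\<exists>b. b \<in> Basis \<and> b \<noteq> (bvec1 :: 'a)" by auto
  then have "(bvec2 :: 'a) \<in> Basis \<and> (bvec2 :: 'a) \<noteq> bvec1"
    unfolding bvec2_def by (rule someI_ex)
  then show "(bvec2 :: 'a) \<in> Basis" "(bvec2 :: 'a) \<noteq> bvec1" by auto
qed

lemma inner_bvec:
  assumes "DIM('a::euclidean_space) > 2"
  shows "(bvec1 :: 'a) \<bullet> bvec1 = 1" "(bvec2 :: 'a) \<bullet> bvec2 = 1"
    "(bvec1 :: 'a) \<bullet> bvec2 = 0" "(bvec2 :: 'a) \<bullet> bvec1 = 0"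
  using bvec2_in_Basis[OF assms] by (auto simp: inner_Basis)

lemma cemb_1 [simp]: "cemb 1 = bvec1"
  by (simp add: cemb_def)

lemma cemb_diff: "cemb (z - w) = cemb z - cemb w"
  by (simp add: cemb_def algebra_simps)

lemma norm_cemb:
  assumes "DIM('a::euclidean_space) > 2"
  shows "norm (cemb z :: 'a) = cmod z"
  by (simp add: norm_eq_sqrt_inner cemb_def inner_bvec[OF assms] inner_add_left inner_add_right
      inner_complex_def)

lemma vpos_simps:
  assumes "completed d G"
  shows "vpos G z x (lab G L0) = 0" "vpos G z x (lab G L1) = bvec1" "vpos G z x (lab G Lz) = cemb z"
    "v \<in> internal_verts G \<Longrightarrow> vpos G z x v = x v"
  using assms unfolding vpos_def by (auto)

text \<open>Edges at infinity contribute 1, as if all vertices had distance 1 from it.\<close>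
definition vdist :: "('v, 'e) cgraph \<Rightarrow> complex \<Rightarrow> ('v \<Rightarrow> 'a::euclidean_space) \<Rightarrow> 'v \<Rightarrow> 'v \<Rightarrow> real" where
  "vdist G z x u v =
     (if u = lab G Linf \<or> v = lab G Linf then 1 else norm (vpos G z x u - vpos G z x v))"

lemma vdist_nonneg: "vdist G z x u v \<ge> 0"
  by (simp add: vdist_def)

text \<open>The two exceptional cases of \<open>edge_factor\<close> become instances of the general
  one: at infinity the base is 1 by the convention in \<open>vdist\<close>, and the points 0 and 1
  really have distance 1. The exponent uses \<open>2 * \<lambda> = d - 2\<close>.\<close>

lemma edge_factor_vdist:
  fixes x :: "'v \<Rightarrow> 'a::euclidean_space"
  assumes "completed d G" "e \<in> edges G"
  shows "edge_factor G z x e = vdist G z x (src G e) (tgt G e) powr (- (real DIM('a) - 2) * wt G e)"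
proof -
  have "- 2 * glambda TYPE('a) * wt G e = - (real DIM('a) - 2) * wt G e"
    by (simp add: glambda_def)
  then show ?thesis
    using assms completedD(7)[OF assms]
    by (auto simp: edge_factor_def vdist_def incident_def doubleton_eq_iff vpos_simps)
qed

lemma measurable_gintegrand:
  assumes G: "completed d G"
  shows "gintegrand G z \<in> borel_measurable (PiM (internal_verts G) (\<lambda>_. lborel :: 'a::euclidean_space measure))"
proof -
  let ?P = "PiM (internal_verts G) (\<lambda>_. lborel :: 'a measure)"
  \<comment> \<open>The vertex at infinity is left out, since its position is not a coordinate of
    the product space; edges meeting it have a constant factor.\<close>
  have pos: "(\<lambda>x. vpos G z x v) \<in> borel_measurable ?P" if "v \<in> verts G" "v \<noteq> lab G Linf" for v
    using that(1)
  proof (cases rule: verts_cases)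
    case internal
    have "(\<lambda>x. x v) \<in> ?P \<rightarrow>\<^sub>M lborel"
      using internal by (rule measurable_component_singleton)
    then show ?thesis
      using internal by (simp add: vpos_simps[OF G])
  next
    case (labelled a)
    with that(2) show ?thesis
      by (cases a) (auto simp: vpos_simps[OF G])
  qed
  have "(\<lambda>x. edge_factor G z x e) \<in> borel_measurable ?P" if "e \<in> edges G" for e
  proof (cases "incident G (lab G Linf) e")
    case True
    then show ?thesis by (simp add: edge_factor_def)
  next
    case False
    then have [measurable]: "(\<lambda>x. vpos G z x (src G e)) \<in> borel_measurable ?P"
       "(\<lambda>x. vpos G z x (tgt G e)) \<in> borel_measurable ?P"
      using that by (auto intro!: pos simp: completedD[OF G] incident_def)
    show ?thesis
      unfolding edge_factor_def by (cases "{src G e, tgt G e} = {lab G L0, lab G L1}") (use False in auto)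
  qed
  then show ?thesis
    unfolding gintegrand_def[abs_def] by (rule borel_measurable_prod)
qed

section \<open>Rescaling of the integrand by vertex weights\<close>

text \<open>Double counting of incident pairs of a vertex and an edge. Summing exponents at a fixed
  vertex gives its weighted valency; at a fixed edge exactly two factors remain, because a completed
  graph has no loops.\<close>

lemma prod_edges_eq_prod_verts:
  assumes G: "completed d G" and A: "\<And>v. v \<in> verts G \<Longrightarrow> A v > (0::real)"
  shows "(\<Prod>e\<in>edges G. (A (src G e) * A (tgt G e)) powr (c * wt G e)) =
    (\<Prod>v\<in>verts G. A v powr (c * wvalency G v))"
proof -
  have "(\<Prod>v\<in>verts G. A v powr (c * wvalency G v)) =
      (\<Prod>v\<in>verts G. \<Prod>e\<in>edges G. if incident G v e then A v powr (c * wt G e) else 1)"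
  proof (intro prod.cong refl)
    fix v assume v: "v \<in> verts G"
    have "A v powr (c * wvalency G v) = (\<Prod>e\<in>{e\<in>edges G. incident G v e}. A v powr (c * wt G e))"
      unfolding wvalency_def sum_distrib_left
      using A[OF v] completedD(2)[OF G] by (subst powr_sum) auto
    then show "A v powr (c * wvalency G v) =
        (\<Prod>e\<in>edges G. if incident G v e then A v powr (c * wt G e) else 1)"
      using completedD(2)[OF G] by (simp add: prod.inter_filter)
  qed
  also have "\<dots> = (\<Prod>e\<in>edges G. \<Prod>v\<in>verts G. if incident G v e then A v powr (c * wt G e) else 1)"
    by (rule prod.swap)
  also have "\<dots> = (\<Prod>e\<in>edges G. (A (src G e) * A (tgt G e)) powr (c * wt G e))"
  proof (intro prod.cong refl)
    fix e assume e: "e \<in> edges G"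
    have "(\<Prod>v\<in>verts G. if incident G v e then A v powr (c * wt G e) else 1) =
        (\<Prod>v\<in>{v\<in>verts G. incident G v e}. A v powr (c * wt G e))"
      using completedD(1)[OF G] by (simp add: prod.inter_filter)
    also have "{v\<in>verts G. incident G v e} = {src G e, tgt G e}"
      using completedD[OF G] e by (auto simp: incident_def)
    also have "(\<Prod>v\<in>{src G e, tgt G e}. A v powr (c * wt G e)) = (A (src G e) * A (tgt G e)) powr (c * wt G e)"
      using completedD(5-7)[OF G e] A by (simp add: powr_mult)
    finally show "(\<Prod>v\<in>verts G. if incident G v e then A v powr (c * wt G e) else 1) =
        (A (src G e) * A (tgt G e)) powr (c * wt G e)" .
  qed
  finally show ?thesis by simp
qed

text \<open>The weights \<open>A\<close> are arbitrary positive numbers on all vertices, infinity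
  included, so that similarities and the inversion are handled by one computation. Distances of
  distinct vertices suffice, since edges join distinct vertices.\<close>

lemma gintegrand_rescale:
  fixes x y :: "'v \<Rightarrow> 'a::euclidean_space"
  assumes dim: "DIM('a) > 2" and G: "completed DIM('a) G" and \<sigma>: "bij \<sigma>"
    and A: "\<And>v. v \<in> verts G \<Longrightarrow> A v > 0"
    and dist: "\<And>u v. u \<in> verts G \<Longrightarrow> v \<in> verts G \<Longrightarrow> u \<noteq> v \<Longrightarrow>
      vdist G z x u v = A u * A v * vdist (relabel \<sigma> G) z' y u v"
  shows "gintegrand (relabel \<sigma> G) z' y =
    (\<Prod>v\<in>internal_verts G. A v powr (2 * real DIM('a))) * gintegrand G z x"
proof -
  let ?c = "real DIM('a) - 2"
  note G' = completed_relabel[OF G \<sigma>]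
  have "edge_factor (relabel \<sigma> G) z' y e =
      (A (src G e) * A (tgt G e)) powr (?c * wt G e) * edge_factor G z x e" if e: "e \<in> edges G" for e
  proof -
    let ?B = "A (src G e) * A (tgt G e)"
    have B: "?B > 0" using A completedD(5,6)[OF G e] by simp
    \<comment> \<open>The weights scale distances from the relabelled graph to \<open>G\<close>;
      solving for the relabelled edge factor therefore reverses the sign of the exponent of
      \<open>?B\<close>.\<close>
    have "edge_factor G z x e = (?B * vdist (relabel \<sigma> G) z' y (src G e) (tgt G e)) powr (- ?c * wt G e)"
      using completedD(5-7)[OF G e] by (simp add: edge_factor_vdist[OF G e] dist)
    also have "\<dots> = ?B powr (- ?c * wt G e) * edge_factor (relabel \<sigma> G) z' y e"
      using B e by (subst powr_mult) (auto simp: vdist_nonneg edge_factor_vdist[OF G'])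
    finally have "?B powr (?c * wt G e) * edge_factor G z x e =
        (?B powr (?c * wt G e) * ?B powr (- ?c * wt G e)) * edge_factor (relabel \<sigma> G) z' y e"
      by simp
    also have "?B powr (?c * wt G e) * ?B powr (- ?c * wt G e) = 1"
      using B by (subst powr_add[symmetric]) (auto simp: algebra_simps)
    finally show ?thesis by simp
  qed
  then have "gintegrand (relabel \<sigma> G) z' y =
      (\<Prod>e\<in>edges G. (A (src G e) * A (tgt G e)) powr (?c * wt G e)) * gintegrand G z x"
    by (simp add: gintegrand_def prod.distrib)
  also have "(\<Prod>e\<in>edges G. (A (src G e) * A (tgt G e)) powr (?c * wt G e)) =
      (\<Prod>v\<in>verts G. A v powr (?c * wvalency G v))"
    using G A by (rule prod_edges_eq_prod_verts)
  \<comment> \<open>Labelled vertices drop out: valency 0 makes the exponent vanish, and the base is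
    positive.\<close>
  also have "\<dots> = (\<Prod>v\<in>internal_verts G. A v powr (?c * wvalency G v))"
    using completedD(1)[OF G]
  proof (intro prod.mono_neutral_right ballI)
    fix v assume "v \<in> verts G - internal_verts G"
    then obtain a where "v = lab G a" "v \<in> verts G" unfolding internal_verts_def by auto
    then show "A v powr (?c * wvalency G v) = 1"
      using A[of v] completedD(9)[OF G] by simp
  qed (auto simp: internal_verts_def)
  \<comment> \<open>The valency \<open>2 * d / (d - 2)\<close> is what turns the exponent into
    \<open>2 * d\<close>, the power that a Jacobian can cancel.\<close>
  also have "\<dots> = (\<Prod>v\<in>internal_verts G. A v powr (2 * real DIM('a)))"
    using dim by (intro prod.cong refl) (simp add: completedD(8)[OF G])
  finally show ?thesis .
qed

section \<open>The substitution principle for graphical functions\<close>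

lemma AE_PiM_lborel:
  assumes I: "finite I" and U: "U \<in> sets borel" "- U \<in> null_sets (lborel :: 'a::euclidean_space measure)"
  shows "AE x in PiM I (\<lambda>_. lborel :: 'a measure). \<forall>i\<in>I. x i \<in> U"
proof -
  interpret P: product_sigma_finite "\<lambda>_. lborel :: 'a measure" by standard
  let ?P = "PiM I (\<lambda>_. lborel :: 'a measure)"
  have "AE x in ?P. x i \<in> U" if i: "i \<in> I" for i
  proof (rule AE_I')
    let ?N = "Pi\<^sub>E I (\<lambda>j. if j = i then - U else UNIV)"
    have "emeasure ?P ?N = (\<Prod>j\<in>I. emeasure lborel (if j = i then - U else UNIV :: 'a set))"
      using U by (intro P.emeasure_PiM I) auto
    \<comment> \<open>The factor at \<open>i\<close> is 0, and in \<open>ennreal\<close> it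
      annihilates the other factors even though they are infinite.\<close>
    also have "\<dots> = 0"
      using I i U(2) by (intro prod_zero) (auto intro!: bexI[of _ i] simp: null_setsD1)
    finally show "?N \<in> null_sets ?P"
      using U I by (auto intro!: null_setsI sets_PiM_I_finite)
    show "{x \<in> space ?P. x i \<notin> U} \<subseteq> ?N"
      by (auto simp: space_PiM PiE_iff extensional_def)
  qed
  then show ?thesis using I by (simp add: AE_finite_all)
qed

text \<open>The integral of the relabelled graph is pulled back along \<open>J\<close> in every
  variable. The assumption \<open>k\<close> makes the Jacobian of each variable equal to
  \<open>A x v\<close> to the power \<open>- 2 * d\<close>, which cancels the vertex factors of
  \<open>gintegrand_rescale\<close>. The weights may depend on the integration point, as they do for
  the inversion, and all conditions are only asked for points in \<open>U\<close>, which covers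
  almost every \<open>x\<close>.\<close>

lemma graphical_function_substitution:
  fixes J :: "'a::euclidean_space \<Rightarrow> 'a" and T :: "'a itself"
  assumes dim: "DIM('a) > 2" and G: "completed DIM('a) G" and \<sigma>: "bij \<sigma>"
    and [measurable]: "J \<in> borel_measurable borel" "k \<in> borel_measurable borel"
    and U: "U \<in> sets borel" "- U \<in> null_sets lborel"
    and der: "\<And>x. x \<in> U \<Longrightarrow> (J has_derivative J' x) (at x)"
    and conf: "\<And>x h. x \<in> U \<Longrightarrow> norm (J' x h) = k x * norm h"
    and kpos: "\<And>x. x \<in> U \<Longrightarrow> k x > 0" and knonneg: "\<And>x. k x \<ge> 0"
    and inj: "inj_on J U"
    and im: "- (J ` U) \<in> null_sets lborel"
    and A: "\<And>x v. \<forall>i\<in>internal_verts G. x i \<in> U \<Longrightarrow> v \<in> verts G \<Longrightarrow> A x v > 0"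
    and k: "\<And>x v. \<forall>i\<in>internal_verts G. x i \<in> U \<Longrightarrow> v \<in> internal_verts G \<Longrightarrow> k (x v) * (A x v)\<^sup>2 = 1"
    and dist: "\<And>x u v. \<forall>i\<in>internal_verts G. x i \<in> U \<Longrightarrow> u \<in> verts G \<Longrightarrow> v \<in> verts G \<Longrightarrow> u \<noteq> v \<Longrightarrow>
      vdist G z x u v =
        A x u * A x v * vdist (relabel \<sigma> G) z' (\<lambda>i\<in>internal_verts G. J (x i)) u v"
  shows "graphical_function T G z = graphical_function T (relabel \<sigma> G) z'"
proof -
  let ?I = "internal_verts G" and ?d = "DIM('a)"
  let ?P = "PiM ?I (\<lambda>_. lborel :: 'a measure)"
  note G' = completed_relabel[OF G \<sigma>]
  note fin = finite_internal_verts[OF G]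
  have meas': "gintegrand (relabel \<sigma> G) z' \<in> borel_measurable ?P"
    using measurable_gintegrand[OF G'] \<sigma> by simp
  have meas: "gintegrand G z \<in> borel_measurable ?P"
    by (rule measurable_gintegrand[OF G])
  have "(\<integral>y. gintegrand (relabel \<sigma> G) z' y \<partial>?P) =
     (\<integral>x. (\<Prod>i\<in>?I. k (x i) ^ ?d) * gintegrand (relabel \<sigma> G) z' (\<lambda>i\<in>?I. J (x i)) \<partial>?P)"
    using knonneg
    by (intro integral_PiM_change_of_variables fin meas' distr_lborel_conformal[OF _ _ U der conf kpos inj im]) auto
  also have "\<dots> = (\<integral>x. gintegrand G z x \<partial>?P)"
  proof (rule integral_cong_AE)
    have "AE x in ?P. \<forall>i\<in>?I. x i \<in> U"
      by (rule AE_PiM_lborel[OF fin U])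
    then show "AE x in ?P. (\<Prod>i\<in>?I. k (x i) ^ ?d) * gintegrand (relabel \<sigma> G) z' (\<lambda>i\<in>?I. J (x i)) = gintegrand G z x"
    proof (rule eventually_mono)
      fix x assume x: "\<forall>i\<in>?I. x i \<in> U"
      have "gintegrand (relabel \<sigma> G) z' (\<lambda>i\<in>?I. J (x i)) =
          (\<Prod>v\<in>?I. A x v powr (2 * real ?d)) * gintegrand G z x"
        by (rule gintegrand_rescale[OF dim G \<sigma>]) (use A[OF x] dist[OF x] in auto)
      moreover have "k (x v) ^ ?d * A x v powr (2 * real ?d) = 1" if v: "v \<in> ?I" for v
      proof -
        have "A x v > 0" using A[OF x] v unfolding internal_verts_def by auto
        then have "A x v powr (2 * real ?d) = ((A x v)\<^sup>2) ^ ?d"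
          by (metis of_nat_mult of_nat_numeral power_mult powr_realpow)
        then show ?thesis
          using k[OF x v] by (simp add: power_mult_distrib[symmetric])
      qed
      ultimately show "(\<Prod>i\<in>?I. k (x i) ^ ?d) * gintegrand (relabel \<sigma> G) z' (\<lambda>i\<in>?I. J (x i)) = gintegrand G z x"
        by (simp add: mult.assoc[symmetric] prod.distrib[symmetric])
    qed
    have [measurable]: "(\<lambda>x. \<lambda>i\<in>?I. J (x i)) \<in> ?P \<rightarrow>\<^sub>M ?P" by measurable
    show "(\<lambda>x. (\<Prod>i\<in>?I. k (x i) ^ ?d) * gintegrand (relabel \<sigma> G) z' (\<lambda>i\<in>?I. J (x i))) \<in> borel_measurable ?P"
      by (intro borel_measurable_times measurable_compose[OF _ meas'] borel_measurable_prod) measurable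
  qed (rule meas)
  finally show ?thesis
    using \<sigma> by (simp add: graphical_function_def gmeasure_def)
qed

section \<open>Similarities and inversion of the space\<close>

text \<open>Complex multiplication by \<open>c\<close> on the plane of the labelled points, extended
  to the whole space: the orthogonal complement is stretched by \<open>cmod c\<close>, which makes
  the map a similarity.\<close>

definition cmult :: "complex \<Rightarrow> 'a::euclidean_space \<Rightarrow> 'a" where
  "cmult c x = cmod c *\<^sub>R (x - (x \<bullet> bvec1) *\<^sub>R bvec1 - (x \<bullet> bvec2) *\<^sub>R bvec2)
     + cemb (c * Complex (x \<bullet> bvec1) (x \<bullet> bvec2))"

lemma linear_cmult: "linear (cmult c)"
  by (rule linearI) (auto simp: cmult_def cemb_def algebra_simps inner_add_left)

lemma cmult_cemb:
  assumes "DIM('a::euclidean_space) > 2"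
  shows "cmult c (cemb z :: 'a) = cemb (c * z)"
  by (simp add: cmult_def cemb_def inner_bvec[OF assms] inner_add_left)

text \<open>Pythagoras for the splitting into the plane and its orthogonal complement, both of which
  are stretched by the same factor.\<close>

lemma norm_cmult:
  assumes "DIM('a::euclidean_space) > 2"
  shows "norm (cmult c x :: 'a) = cmod c * norm x"
proof -
  define p where "p = x - (x \<bullet> bvec1) *\<^sub>R bvec1 - (x \<bullet> bvec2) *\<^sub>R bvec2"
  define w where "w = Complex (x \<bullet> bvec1) (x \<bullet> bvec2)"
  have orth: "orthogonal p (cemb u)" for u
    by (simp add: orthogonal_def p_def cemb_def inner_bvec[OF assms] inner_diff_left inner_add_right)
  have "x = p + cemb w" by (simp add: p_def w_def cemb_def)
  then have "(norm x)\<^sup>2 = (norm p)\<^sup>2 + (cmod w)\<^sup>2"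
    using norm_add_Pythagorean[OF orth] norm_cemb[OF assms] by metis
  moreover have "(norm (cmult c x))\<^sup>2 = (cmod c * norm p)\<^sup>2 + (cmod c * cmod w)\<^sup>2"
    using norm_add_Pythagorean[of "cmod c *\<^sub>R p" "cemb (c * w)"] orth
    by (simp add: cmult_def p_def[symmetric] w_def[symmetric] orthogonal_clauses norm_cemb[OF assms] norm_mult)
  ultimately have "(norm (cmult c x))\<^sup>2 = (cmod c * norm x)\<^sup>2"
    by (simp add: power_mult_distrib algebra_simps)
  then show ?thesis by (simp add: power2_eq_iff_nonneg)
qed

section \<open>Reflected inversion and its conformal factor\<close>

definition reflect2 :: "'a::euclidean_space \<Rightarrow> 'a" where
  "reflect2 x = x - (2 * (x \<bullet> bvec2)) *\<^sub>R bvec2"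

lemma linear_reflect2: "linear reflect2"
  by (rule linearI) (auto simp: reflect2_def algebra_simps inner_add_left)

lemma norm_reflect2:
  assumes "DIM('a::euclidean_space) > 2"
  shows "norm (reflect2 x :: 'a) = norm x"
  by (simp add: norm_eq_sqrt_inner reflect2_def inner_diff_left inner_diff_right inner_bvec[OF assms]
      inner_commute algebra_simps)

lemma reflect2_reflect2:
  assumes "DIM('a::euclidean_space) > 2"
  shows "reflect2 (reflect2 x :: 'a) = x"
proof -
  have "reflect2 x \<bullet> bvec2 = - (x \<bullet> bvec2)"
    by (simp add: reflect2_def inner_diff_left inner_bvec[OF assms])
  then have "reflect2 (reflect2 x) = reflect2 x + (2 * (x \<bullet> bvec2)) *\<^sub>R bvec2"
    by (simp add: reflect2_def[of "reflect2 x"])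
  also have "\<dots> = x"
    unfolding reflect2_def by simp
  finally show ?thesis .
qed

lemma reflect2_cemb:
  assumes "DIM('a::euclidean_space) > 2"
  shows "reflect2 (cemb z :: 'a) = cemb (cnj z)"
proof -
  have "(cemb z :: 'a) \<bullet> bvec2 = Im z"
    by (simp add: cemb_def inner_add_left inner_bvec[OF assms])
  then have "reflect2 (cemb z :: 'a) = cemb z - Im z *\<^sub>R bvec2 - Im z *\<^sub>R bvec2"
    by (simp only: reflect2_def mult_2 scaleR_add_left diff_diff_add)
  then show ?thesis by (simp add: cemb_def)
qed

text \<open>The sphere inversion alone acts on the complex plane as the map z to 1 / cnj z; the reflection
  makes it holomorphic.\<close>
definition reflected_inversion :: "'a::euclidean_space \<Rightarrow> 'a" where
  "reflected_inversion x = (1 / (x \<bullet> x)) *\<^sub>R reflect2 x"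

lemma reflected_inversion_cemb:
  assumes "DIM('a::euclidean_space) > 2"
  shows "reflected_inversion (cemb z :: 'a) = cemb (1 / z)"
proof -
  have "(cemb z :: 'a) \<bullet> cemb z = (cmod z)\<^sup>2"
    by (simp add: dot_square_norm norm_cemb[OF assms])
  moreover have "1 / z = (1 / (cmod z)\<^sup>2) *\<^sub>R cnj z"
    by (simp add: complex_div_cnj[of 1 z] scaleR_conv_of_real)
  moreover have "cemb (r *\<^sub>R w) = r *\<^sub>R (cemb w :: 'a)" for r w
    by (simp add: cemb_def algebra_simps)
  ultimately show ?thesis
    by (simp add: reflected_inversion_def reflect2_cemb[OF assms])
qed

lemma norm_reflected_inversion:
  assumes "DIM('a::euclidean_space) > 2"
  shows "norm (reflected_inversion x :: 'a) = 1 / norm x"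
  by (simp add: reflected_inversion_def norm_reflect2[OF assms] dot_square_norm power2_eq_square)

lemma reflected_inversion_involution:
  assumes "DIM('a::euclidean_space) > 2" "(x :: 'a) \<noteq> 0"
  shows "reflected_inversion (reflected_inversion x) = x"
proof -
  have "reflected_inversion x \<bullet> reflected_inversion x = 1 / (x \<bullet> x)"
    by (simp add: dot_square_norm norm_reflected_inversion[OF assms(1)] power_one_over)
  moreover have "reflect2 (reflected_inversion x) = (1 / (x \<bullet> x)) *\<^sub>R x"
    by (simp add: reflected_inversion_def linear_cmul[OF linear_reflect2] reflect2_reflect2[OF assms(1)])
  ultimately show ?thesis
    using assms(2) by (subst reflected_inversion_def) simp
qed

text \<open>As the reflection is a linear isometry, only the sphere inversion matters, and expanding
  the squared norm gives the quotient. This is the distance rule of the opening comment with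
  \<open>a x = norm x\<close>.\<close>

lemma norm_reflected_inversion_diff:
  assumes "DIM('a::euclidean_space) > 2" "(x :: 'a) \<noteq> 0" "y \<noteq> 0"
  shows "norm (reflected_inversion x - reflected_inversion y) = norm (x - y) / (norm x * norm y)"
proof -
  let ?v = "(1 / (x \<bullet> x)) *\<^sub>R x - (1 / (y \<bullet> y)) *\<^sub>R y"
  have "reflected_inversion x - reflected_inversion y = reflect2 ?v"
    by (simp add: reflected_inversion_def linear_diff[OF linear_reflect2] linear_cmul[OF linear_reflect2])
  then have "norm (reflected_inversion x - reflected_inversion y) = norm ?v"
    by (simp add: norm_reflect2[OF assms(1)])
  also have "\<dots> = norm (x - y) / (norm x * norm y)"
  proof (rule power2_eq_imp_eq)
    have pos: "x \<bullet> x > 0" "y \<bullet> y > 0" using assms by auto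
    have "(norm ?v)\<^sup>2 = 1 / (x \<bullet> x) - 2 * (x \<bullet> y) / ((x \<bullet> x) * (y \<bullet> y)) + 1 / (y \<bullet> y)"
      using pos by (simp add: power2_norm_eq_inner inner_diff_left inner_diff_right inner_commute field_simps)
    also have "\<dots> = (x \<bullet> x - 2 * (x \<bullet> y) + y \<bullet> y) / ((x \<bullet> x) * (y \<bullet> y))"
      using pos by (simp add: field_simps)
    also have "\<dots> = (norm (x - y) / (norm x * norm y))\<^sup>2"
      by (simp add: power_divide power_mult_distrib power2_norm_eq_inner inner_diff_left inner_diff_right
          inner_commute algebra_simps)
    finally show "(norm ?v)\<^sup>2 = (norm (x - y) / (norm x * norm y))\<^sup>2" .
  qed auto
  finally show ?thesis .
qed

lemma reflected_inversion_has_derivative: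
  assumes "(x :: 'a::euclidean_space) \<noteq> 0"
  shows "(reflected_inversion has_derivative
    (\<lambda>h. reflect2 ((1 / (x \<bullet> x)) *\<^sub>R h - (2 * (x \<bullet> h) / (x \<bullet> x)\<^sup>2) *\<^sub>R x))) (at x)"
proof -
  have bl: "bounded_linear (reflect2 :: 'a \<Rightarrow> 'a)"
    using linear_reflect2 linear_conv_bounded_linear by blast
  have "((\<lambda>x. (1 / (x \<bullet> x)) *\<^sub>R x) has_derivative
     (\<lambda>h. (1 / (x \<bullet> x)) *\<^sub>R h - (2 * (x \<bullet> h) / (x \<bullet> x)\<^sup>2) *\<^sub>R x)) (at x)"
    using assms
    by (auto intro!: derivative_eq_intros simp: fun_eq_iff inner_commute power2_eq_square algebra_simps)
  from bounded_linear.has_derivative[OF bl this] show ?thesis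
    by (simp add: reflected_inversion_def[abs_def] linear_cmul[OF linear_reflect2])
qed

text \<open>Before \<open>reflect2\<close>, the derivative is \<open>1 / (x \<bullet> x)\<close>
  times the reflection of \<open>h\<close> in the hyperplane orthogonal to \<open>x\<close>. Both
  reflections preserve the norm, which leaves the conformal factor.\<close>

lemma norm_reflected_inversion_derivative:
  assumes "DIM('a::euclidean_space) > 2" "(x :: 'a) \<noteq> 0"
  shows "norm (reflect2 ((1 / (x \<bullet> x)) *\<^sub>R h - (2 * (x \<bullet> h) / (x \<bullet> x)\<^sup>2) *\<^sub>R x)) = 1 / (x \<bullet> x) * norm h"
proof -
  let ?v = "(1 / (x \<bullet> x)) *\<^sub>R h - (2 * (x \<bullet> h) / (x \<bullet> x)\<^sup>2) *\<^sub>R x"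
  have pos: "x \<bullet> x > 0" using assms by auto
  have "norm ?v = 1 / (x \<bullet> x) * norm h"
  proof (rule power2_eq_imp_eq)
    have "(norm (a *\<^sub>R h - b *\<^sub>R x))\<^sup>2 = a\<^sup>2 * (h \<bullet> h) - 2 * a * b * (x \<bullet> h) + b\<^sup>2 * (x \<bullet> x)" for a b
      unfolding power2_norm_eq_inner
      by (simp add: inner_diff_left inner_diff_right inner_commute power2_eq_square algebra_simps)
    then have "(norm ?v)\<^sup>2 = (1 / (x \<bullet> x))\<^sup>2 * (h \<bullet> h)
        - 2 * (1 / (x \<bullet> x)) * (2 * (x \<bullet> h) / (x \<bullet> x)\<^sup>2) * (x \<bullet> h)
        + (2 * (x \<bullet> h) / (x \<bullet> x)\<^sup>2)\<^sup>2 * (x \<bullet> x)" .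
    also have "\<dots> = (h \<bullet> h) / (x \<bullet> x)\<^sup>2"
      using pos by (simp add: power2_eq_square field_simps)
    also have "\<dots> = (1 / (x \<bullet> x) * norm h)\<^sup>2"
      by (simp add: power_divide power2_norm_eq_inner)
    finally show "(norm ?v)\<^sup>2 = (1 / (x \<bullet> x) * norm h)\<^sup>2" .
  qed auto
  then show ?thesis by (simp add: norm_reflect2[OF assms(1)])
qed

section \<open>The three generating transpositions\<close>

lemma lab_relabel_transpose:
  "lab (relabel (Transposition.transpose a b) G) c = lab G (Transposition.transpose a b c)"
  using lab_relabel[of "Transposition.transpose a b" G "Transposition.transpose a b c"] by simp

lemma vpos_relabel_transpose:
  assumes G: "completed d G"
  shows "vpos (relabel (Transposition.transpose a b) G) z y (lab G (Transposition.transpose a b L0)) = 0"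
    "vpos (relabel (Transposition.transpose a b) G) z y (lab G (Transposition.transpose a b L1)) = bvec1"
    "vpos (relabel (Transposition.transpose a b) G) z y (lab G (Transposition.transpose a b Lz)) = cemb z"
    "v \<in> internal_verts G \<Longrightarrow> vpos (relabel (Transposition.transpose a b) G) z y v = y v"
proof -
  note G' = completed_relabel[OF G, of "Transposition.transpose a b"]
  show "vpos (relabel (Transposition.transpose a b) G) z y (lab G (Transposition.transpose a b L0)) = 0"
    "vpos (relabel (Transposition.transpose a b) G) z y (lab G (Transposition.transpose a b L1)) = bvec1"
    "vpos (relabel (Transposition.transpose a b) G) z y (lab G (Transposition.transpose a b Lz)) = cemb z"
    "v \<in> internal_verts G \<Longrightarrow> vpos (relabel (Transposition.transpose a b) G) z y v = y v"
    using vpos_simps[OF G'] by (simp_all add: lab_relabel_transpose)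
qed

text \<open>Serves both transpositions that fix infinity. An affine similarity scales all finite
  distances by \<open>c\<close>, so its conformal factor is constant, and only its effect on the
  three finite labelled points has to be checked in each application.\<close>

lemma graphical_function_similarity:
  fixes L :: "'a::euclidean_space \<Rightarrow> 'a" and T :: "'a itself" and G :: "('v, 'e) cgraph"
  assumes dim: "DIM('a) > 2" and G: "completed DIM('a) G" and \<sigma>: "bij \<sigma>" and fixinf: "\<sigma> Linf = Linf"
    and lin: "linear L" and norm: "\<And>x. norm (L x) = c * norm x" and c: "c > 0"
    and vpos: "\<And>x a. a \<noteq> Linf \<Longrightarrow> vpos (relabel \<sigma> G) z' x (lab G a) = t + L (vpos G z x (lab G a))"
  shows "graphical_function T G z = graphical_function T (relabel \<sigma> G) z'"
proof -
  let ?J = "\<lambda>x. t + L x"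
  have bl: "bounded_linear L"
    using lin linear_conv_bounded_linear by blast
  have eq0: "L x = 0 \<Longrightarrow> x = 0" for x
    using norm[of x] c by simp
  have inj: "inj L"
    using eq0 linear_injective_0[OF lin] by blast
  then have surj: "surj L"
    using lin linear_injective_imp_surjective by blast
  have inf': "lab (relabel \<sigma> G) Linf = lab G Linf"
    using lab_relabel[OF \<sigma>, of G Linf] fixinf by simp
  note G' = completed_relabel[OF G \<sigma>]
  \<comment> \<open>Edges at infinity keep the factor 1, so the weight at infinity has to be inverse to the others.\<close>
  define s where "s = 1 / sqrt c"
  have s: "s > 0" "c * s\<^sup>2 = 1"
    using c by (auto simp: s_def power_one_over)
  show ?thesis
  proof (rule graphical_function_substitution[OF dim G \<sigma>, of ?J "\<lambda>_. c" UNIV "\<lambda>_. L"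
      "\<lambda>x v. if v = lab G Linf then 1 / s else s"])
    show "?J \<in> borel_measurable borel"
      by (intro borel_measurable_continuous_onI continuous_intros linear_continuous_on bl)
    show "(?J has_derivative L) (at x)" for x
      using has_derivative_add[OF has_derivative_const bounded_linear_imp_has_derivative[OF bl]] by simp
    show "norm (L h) = c * norm h" for h by (rule norm)
    show "c > 0" "c \<ge> 0" using c by simp_all
    show "(if v = lab G Linf then 1 / s else s) > 0" for v using s(1) by simp
    show "inj ?J" using inj by (auto simp: inj_on_def)
    have "range ?J = UNIV"
      using surj by (metis (no_types, lifting) UNIV_eq_I add.commute diff_add_cancel rangeI surj_def)
    then show "- range ?J \<in> null_sets lborel" by simp
    show "c * (if v = lab G Linf then 1 / s else s)\<^sup>2 = 1" if "v \<in> internal_verts G" for v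
      using that s by auto
    fix x :: "'v \<Rightarrow> 'a" and u v
    let ?y = "\<lambda>i\<in>internal_verts G. ?J (x i)"
    assume uv: "u \<in> verts G" "v \<in> verts G" "u \<noteq> v"
    have J: "vpos (relabel \<sigma> G) z' ?y v = ?J (vpos G z x v)" if v: "v \<in> verts G" "v \<noteq> lab G Linf" for v
      using v(1)
    proof (cases rule: verts_cases)
      case internal
      then show ?thesis
        using \<sigma> by (simp add: vpos_simps[OF G] vpos_simps[OF G'])
    next
      case (labelled a)
      with v have a: "a \<noteq> Linf" by auto
      then have "\<sigma> a \<noteq> Linf" using fixinf \<sigma> by (metis bij_is_inj injD)
      \<comment> \<open>Finite labels sit at fixed positions, so \<open>?y\<close> may be replaced
        by \<open>x\<close>, the assignment to which the assumption \<open>vpos\<close> is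
        applied.\<close>
      then have "vpos (relabel \<sigma> G) z' ?y (lab (relabel \<sigma> G) (\<sigma> a)) =
          vpos (relabel \<sigma> G) z' x (lab (relabel \<sigma> G) (\<sigma> a))"
        by (cases "\<sigma> a") (simp_all add: vpos_simps[OF G'])
      then show ?thesis
        using a vpos[of a x] labelled lab_relabel[OF \<sigma>, of G a] by simp
    qed
    show "vdist G z x u v = (if u = lab G Linf then 1 / s else s) * (if v = lab G Linf then 1 / s else s) *
       vdist (relabel \<sigma> G) z' ?y u v"
    \<comment> \<open>With the vertex at infinity the weights multiply to
      \<open>1 / s * s = 1\<close>; between finite vertices \<open>s * s\<close> cancels the factor
      \<open>c\<close>.\<close>
    proof (cases "u = lab G Linf \<or> v = lab G Linf")
      case True
      then show ?thesis
        using uv(3) s(1) by (cases "u = lab G Linf") (simp_all add: vdist_def inf')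
    next
      case False
      have "?J p - ?J q = L (p - q)" for p q
        by (simp add: linear_diff[OF lin])
      then have "norm (vpos (relabel \<sigma> G) z' ?y u - vpos (relabel \<sigma> G) z' ?y v) =
          c * norm (vpos G z x u - vpos G z x v)"
        using uv False by (simp add: J norm)
      then show ?thesis
        using False s(2) by (simp add: vdist_def inf' power2_eq_square mult_ac)
    qed
  qed simp_all
qed

lemma graphical_function_swap_01:
  fixes T :: "'a::euclidean_space itself" and G :: "('v, 'e) cgraph"
  assumes dim: "DIM('a) > 2" and G: "completed DIM('a) G"
  shows "graphical_function T G z =
    graphical_function T (relabel (Transposition.transpose L0 L1) G) (1 - z)"
proof (rule graphical_function_similarity[OF dim G, where c=1 and L=uminus and t=bvec1])
  show "linear (uminus :: 'a \<Rightarrow> 'a)" by (rule linearI) auto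
  show "vpos (relabel (Transposition.transpose L0 L1) G) (1 - z) x (lab G a) = bvec1 + - vpos G z x (lab G a)"
    if "a \<noteq> Linf" for a and x :: "'v \<Rightarrow> 'a"
    using that vpos_simps(1-3)[OF G, of z x] vpos_relabel_transpose(1-3)[OF G, of L0 L1 "1 - z" x]
    by (cases a) (simp_all add: cemb_diff)
qed simp_all

text \<open>Multiplication by \<open>1 / z\<close> fixes 0, moves the point \<open>z\<close> to 1
  and the point 1 to \<open>1 / z\<close>.\<close>

lemma graphical_function_swap_1z:
  fixes T :: "'a::euclidean_space itself" and G :: "('v, 'e) cgraph"
  assumes dim: "DIM('a) > 2" and G: "completed DIM('a) G" and z: "z \<noteq> 0"
  shows "graphical_function T G z =
    graphical_function T (relabel (Transposition.transpose L1 Lz) G) (1 / z)"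
proof (rule graphical_function_similarity[OF dim G, where c="cmod (1 / z)" and L="cmult (1 / z)" and t=0])
  show "vpos (relabel (Transposition.transpose L1 Lz) G) (1 / z) x (lab G a) = 0 + cmult (1 / z) (vpos G z x (lab G a))"
    if "a \<noteq> Linf" for a and x :: "'v \<Rightarrow> 'a"
    using that z vpos_simps(1-3)[OF G, of z x] vpos_relabel_transpose(1-3)[OF G, of L1 Lz "1 / z" x]
      cmult_cemb[OF dim, of "1 / z" 1] cmult_cemb[OF dim, of "1 / z" z] linear_0[OF linear_cmult[of "1 / z"]]
    by (cases a) auto
  show "norm (cmult (1 / z) x :: 'a) = cmod (1 / z) * norm x" for x
    by (rule norm_cmult[OF dim])
  show "cmod (1 / z) > 0" using z by simp
qed (simp_all add: linear_cmult)

text \<open>The reflected inversion exchanges 0 and infinity, fixes 1 and moves \<open>z\<close> to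
  \<open>1 / z\<close>. It is singular only at 0, a null set.\<close>

lemma graphical_function_swap_0inf:
  fixes T :: "'a::euclidean_space itself" and G :: "('v, 'e) cgraph"
  assumes dim: "DIM('a) > 2" and G: "completed DIM('a) G" and z: "z \<noteq> 0"
  shows "graphical_function T G z =
    graphical_function T (relabel (Transposition.transpose L0 Linf) G) (1 / z)"
proof -
  let ?G' = "relabel (Transposition.transpose L0 Linf) G"
  let ?J = "reflected_inversion :: 'a \<Rightarrow> 'a"
  \<comment> \<open>Weight 1 at the two exchanged vertices fits the convention at infinity. The
    distance of \<open>v\<close> from the old 0 is the norm of its position, while the new distance
    is 1; the old distance from infinity is 1, while the new one is the inverse of that
    norm.\<close>
  define A where "A = (\<lambda>(x :: 'v \<Rightarrow> 'a) v. if v = lab G L0 \<or> v = lab G Linf then 1 else norm (vpos G z x v))"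
  have inf': "lab ?G' Linf = lab G L0" by (simp add: lab_relabel_transpose)
  have cz: "cemb z \<noteq> (0 :: 'a)" using norm_cemb[OF dim, of z] z by auto
  have J1: "?J bvec1 = bvec1" using reflected_inversion_cemb[OF dim, of 1] by simp
  have im: "?J ` (- {0}) = - {0}"
  proof (intro set_eqI iffI)
    fix y :: 'a assume "y \<in> - {0}"
    then show "y \<in> ?J ` (- {0})"
      using reflected_inversion_involution[OF dim, of y] norm_reflected_inversion[OF dim, of y]
      by (intro image_eqI[of _ _ "?J y"]) auto
  next
    fix y :: 'a assume "y \<in> ?J ` (- {0})"
    then obtain x where "x \<noteq> 0" "y = ?J x" by auto
    then show "y \<in> - {0}"
      using norm_reflected_inversion[OF dim, of x] by auto
  qed
  show ?thesis
  proof (rule graphical_function_substitution[OF dim G, of _ ?J "\<lambda>x. 1 / (x \<bullet> x)" "- {0}"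
      "\<lambda>x h. reflect2 ((1 / (x \<bullet> x)) *\<^sub>R h - (2 * (x \<bullet> h) / (x \<bullet> x)\<^sup>2) *\<^sub>R x)" A])
    show "?J \<in> borel_measurable borel"
      unfolding reflected_inversion_def[abs_def] reflect2_def[abs_def] by measurable
    show "inj_on ?J (- {0})"
      by (rule inj_on_inverseI[of _ ?J]) (simp add: reflected_inversion_involution[OF dim])
    show "- ?J ` (- {0}) \<in> null_sets lborel"
      unfolding im by (simp add: finite_imp_null_set_lborel)
    fix x :: "'v \<Rightarrow> 'a"
    assume x: "\<forall>i\<in>internal_verts G. x i \<in> - {0}"
    have nz: "vpos G z x v \<noteq> 0" if v: "v \<in> verts G" "v \<noteq> lab G L0" "v \<noteq> lab G Linf" for v
      using v(1)
    proof (cases rule: verts_cases)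
      case internal
      then show ?thesis using x by (simp add: vpos_simps[OF G])
    next
      case (labelled a)
      then show ?thesis using v cz nonzero_Basis[OF bvec1_in_Basis] by (cases a) (auto simp: vpos_simps[OF G])
    qed
    then show "A x v > 0" if "v \<in> verts G" for v
      using that by (simp add: A_def)
    show "1 / (x v \<bullet> x v) * (A x v)\<^sup>2 = 1" if "v \<in> internal_verts G" for v
      using that x by (auto simp: A_def vpos_simps[OF G] dot_square_norm)
    fix u v
    let ?y = "\<lambda>i\<in>internal_verts G. ?J (x i)"
    assume uv: "u \<in> verts G" "v \<in> verts G" "u \<noteq> v"
    have J: "vpos ?G' (1 / z) ?y v = ?J (vpos G z x v)"
      if v: "v \<in> verts G" "v \<noteq> lab G L0" "v \<noteq> lab G Linf" for v
      using v(1)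
    proof (cases rule: verts_cases)
      case internal
      then show ?thesis
        by (simp add: vpos_simps[OF G] vpos_relabel_transpose[OF G])
    next
      case (labelled a)
      then show ?thesis
        using v J1 reflected_inversion_cemb[OF dim, of z] vpos_simps(1-3)[OF G, of z x]
          vpos_relabel_transpose(1-3)[OF G, of L0 Linf "1 / z" ?y]
        by (cases a) auto
    qed
    have J0: "vpos ?G' (1 / z) ?y (lab G Linf) = 0"
      using vpos_relabel_transpose(1)[OF G, of L0 Linf] by simp
    \<comment> \<open>The first two cases include the pair of 0 and infinity, whose distance is 1
      before and after.\<close>
    consider "u = lab G L0" | "v = lab G L0" | "u = lab G Linf" "v \<noteq> lab G L0" "v \<noteq> lab G Linf"
      | "v = lab G Linf" "u \<noteq> lab G L0" "u \<noteq> lab G Linf"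
      | "u \<noteq> lab G L0" "u \<noteq> lab G Linf" "v \<noteq> lab G L0" "v \<noteq> lab G Linf"
      using uv(3) by blast
    then show "vdist G z x u v = A x u * A x v * vdist ?G' (1 / z) ?y u v"
    proof cases
      case 5
      then show ?thesis
        using uv nz[of u] nz[of v]
        by (simp add: vdist_def A_def inf' J norm_reflected_inversion_diff[OF dim])
    qed (use uv nz in \<open>auto simp: lab_eq_iff[OF G] vdist_def A_def inf' J J0 vpos_simps[OF G] norm_reflected_inversion[OF dim]\<close>)
  qed (auto intro: reflected_inversion_has_derivative simp: norm_reflected_inversion_derivative[OF dim] finite_imp_null_set_lborel)
qed

section \<open>From the generators to all permutations\<close>

text \<open>Transpositions along the path Linf - L0 - L1 - Lz generate all permutations of the labels.\<close>
lemma label_permutation_induct: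
  assumes "bij (\<sigma> :: label \<Rightarrow> label)"
    and comp: "\<And>\<sigma> \<tau>. P \<sigma> \<Longrightarrow> P \<tau> \<Longrightarrow> P (\<sigma> \<circ> \<tau>)"
    and gen: "P (Transposition.transpose L0 Linf)" "P (Transposition.transpose L0 L1)"
      "P (Transposition.transpose L1 Lz)"
  shows "P \<sigma>"
proof -
  let ?t = "Transposition.transpose :: label \<Rightarrow> label \<Rightarrow> label \<Rightarrow> label"
  have conj: "P (?t a c)" if "P (?t a b)" "P (?t b c)" "a \<noteq> c" "b \<noteq> c" for a b c
  proof -
    \<comment> \<open>Conjugating one transposition by another that shares a label moves the shared
      label, so two adjacent steps of the path give the transposition of their ends.\<close>
    have "?t a c = ?t a b \<circ> ?t b c \<circ> ?t a b"
      using that(3,4) by (auto simp: fun_eq_iff Transposition.transpose_def)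
    then show ?thesis using comp that by simp
  qed
  have P_id: "P id"
    using comp[OF gen(1) gen(1)] by simp
  have "P (?t Linf L1)" "P (?t L0 Lz)"
    using conj[of Linf L0 L1] conj[of L0 L1 Lz] gen by (simp_all add: transpose_commute)
  moreover from this have "P (?t Linf Lz)"
    using conj[of Linf L1 Lz] gen by simp
  ultimately have tr: "P (?t a b)" if "a \<noteq> b" for a b
    using gen that by (cases a; cases b) (simp_all add: transpose_commute)
  have "UNIV = {L0, L1, Lz, Linf}" by (auto intro: label.exhaust)
  then have fin: "finite (UNIV :: label set)" by (metis finite.simps)
  have "\<sigma> permutes UNIV"
    using assms(1) by (simp add: permutes_def bij_iff)
  from this fin show ?thesis
  proof (induction rule: permutes_induct)
    case id
    show ?case by (rule P_id)
  next
    case (swap a b p)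
    then show ?case by (intro comp tr)
  qed
qed

theorem mainTheorem11:
  fixes T :: "'a::euclidean_space itself"
    and \<Gamma> :: "('v, 'e) cgraph"
  assumes "DIM('a) > 2"
    and "completed DIM('a) \<Gamma>"
    and "gf_converges T \<Gamma>"
  shows "(\<forall>z. z \<noteq> 0 \<and> z \<noteq> 1 \<longrightarrow>
            graphical_function T \<Gamma> z = graphical_function T (relabel (Transposition.transpose L0 Linf) \<Gamma>) (1 / z) \<and>
            graphical_function T \<Gamma> z = graphical_function T (relabel (Transposition.transpose L0 L1) \<Gamma>) (1 - z) \<and>
            graphical_function T \<Gamma> z = graphical_function T (relabel (Transposition.transpose L1 Lz) \<Gamma>) (1 / z)) \<and>
         (\<forall>\<phi> :: (label \<Rightarrow> label) \<Rightarrow> complex \<Rightarrow> complex.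
            (\<forall>\<sigma> \<tau>. bij \<sigma> \<longrightarrow> bij \<tau> \<longrightarrow>
                (\<forall>z. z \<noteq> 0 \<and> z \<noteq> 1 \<longrightarrow> \<phi> (\<sigma> \<circ> \<tau>) z = \<phi> \<sigma> (\<phi> \<tau> z))) \<and>
            (\<forall>z. z \<noteq> 0 \<and> z \<noteq> 1 \<longrightarrow>
                \<phi> (Transposition.transpose L0 Linf) z = 1 / z \<and>
                \<phi> (Transposition.transpose L1 Lz) z = 1 / z \<and>
                \<phi> (Transposition.transpose L0 L1) z = 1 - z) \<longrightarrow>
            (\<forall>\<sigma>. bij \<sigma> \<longrightarrow>
               (\<forall>z. z \<noteq> 0 \<and> z \<noteq> 1 \<longrightarrow>
                  graphical_function T \<Gamma> z = graphical_function T (relabel \<sigma> \<Gamma>) (\<phi> \<sigma> z))))"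
proof (intro conjI allI impI; (elim conjE)?)
  fix z :: complex assume z: "z \<noteq> 0" "z \<noteq> 1"
  show "graphical_function T \<Gamma> z = graphical_function T (relabel (Transposition.transpose L0 Linf) \<Gamma>) (1 / z)"
    using assms(1,2) z(1) by (rule graphical_function_swap_0inf)
  show "graphical_function T \<Gamma> z = graphical_function T (relabel (Transposition.transpose L0 L1) \<Gamma>) (1 - z)"
    using assms(1,2) by (rule graphical_function_swap_01)
  show "graphical_function T \<Gamma> z = graphical_function T (relabel (Transposition.transpose L1 Lz) \<Gamma>) (1 / z)"
    using assms(1,2) z(1) by (rule graphical_function_swap_1z)
next
  fix \<phi> :: "(label \<Rightarrow> label) \<Rightarrow> complex \<Rightarrow> complex" and \<sigma> :: "label \<Rightarrow> label" and z :: complex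
  assume hom: "\<forall>\<sigma> \<tau>. bij \<sigma> \<longrightarrow> bij \<tau> \<longrightarrow> (\<forall>z. z \<noteq> 0 \<and> z \<noteq> 1 \<longrightarrow> \<phi> (\<sigma> \<circ> \<tau>) z = \<phi> \<sigma> (\<phi> \<tau> z))"
    and gen: "\<forall>z. z \<noteq> 0 \<and> z \<noteq> 1 \<longrightarrow>
                \<phi> (Transposition.transpose L0 Linf) z = 1 / z \<and>
                \<phi> (Transposition.transpose L1 Lz) z = 1 / z \<and>
                \<phi> (Transposition.transpose L0 L1) z = 1 - z"
    and \<sigma>: "bij \<sigma>" and z: "z \<noteq> 0" "z \<noteq> 1"
  \<comment> \<open>The graph is quantified because the composition step applies the claim for
    \<sigma> to \<open>relabel \<tau> G\<close>. That \<phi> avoids the values 0 and 1 is carried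
    along, since that claim is used at the point \<open>\<phi> \<tau> z\<close>; the hypotheses on
    \<phi> provide it directly only for the generators.\<close>
  define P where "P \<sigma> \<longleftrightarrow> bij \<sigma> \<and> (\<forall>(G :: ('v, 'e) cgraph) z. completed DIM('a) G \<longrightarrow> z \<noteq> 0 \<longrightarrow> z \<noteq> 1 \<longrightarrow>
    \<phi> \<sigma> z \<noteq> 0 \<and> \<phi> \<sigma> z \<noteq> 1 \<and> graphical_function T G z = graphical_function T (relabel \<sigma> G) (\<phi> \<sigma> z))" for \<sigma>
  have "P \<sigma>"
    using \<sigma>
  proof (rule label_permutation_induct)
    fix \<sigma> \<tau> assume P: "P \<sigma>" "P \<tau>"
    then have "bij \<sigma>" "bij \<tau>" by (auto simp: P_def)
    show "P (\<sigma> \<circ> \<tau>)"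
      unfolding P_def
    proof (intro conjI allI impI)
      show "bij (\<sigma> \<circ> \<tau>)" using \<open>bij \<tau>\<close> \<open>bij \<sigma>\<close> by (rule bij_comp)
      fix G :: "('v, 'e) cgraph" and z :: complex
      assume G: "completed DIM('a) G" and z: "z \<noteq> 0" "z \<noteq> 1"
      have \<phi>: "\<phi> (\<sigma> \<circ> \<tau>) z = \<phi> \<sigma> (\<phi> \<tau> z)"
        using hom \<open>bij \<sigma>\<close> \<open>bij \<tau>\<close> z by blast
      have G\<tau>: "completed DIM('a) (relabel \<tau> G)"
        using G \<open>bij \<tau>\<close> by (rule completed_relabel)
      have \<tau>: "\<phi> \<tau> z \<noteq> 0" "\<phi> \<tau> z \<noteq> 1"
        "graphical_function T G z = graphical_function T (relabel \<tau> G) (\<phi> \<tau> z)"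
        using P(2) G z unfolding P_def by blast+
      with P(1) G\<tau> have "\<phi> \<sigma> (\<phi> \<tau> z) \<noteq> 0" "\<phi> \<sigma> (\<phi> \<tau> z) \<noteq> 1"
        "graphical_function T (relabel \<tau> G) (\<phi> \<tau> z) =
         graphical_function T (relabel \<sigma> (relabel \<tau> G)) (\<phi> \<sigma> (\<phi> \<tau> z))"
        unfolding P_def by blast+
      then show "\<phi> (\<sigma> \<circ> \<tau>) z \<noteq> 0" "\<phi> (\<sigma> \<circ> \<tau>) z \<noteq> 1"
        "graphical_function T G z = graphical_function T (relabel (\<sigma> \<circ> \<tau>) G) (\<phi> (\<sigma> \<circ> \<tau>) z)"
        using \<tau>(3) by (simp_all only: \<phi> relabel_comp[OF \<open>bij \<sigma>\<close> \<open>bij \<tau>\<close>] not_False_eq_True)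
    qed
  next
    show "P (Transposition.transpose L0 Linf)"
      unfolding P_def using gen by (auto intro!: graphical_function_swap_0inf[OF assms(1)])
    show "P (Transposition.transpose L0 L1)"
      unfolding P_def using gen by (auto intro!: graphical_function_swap_01[OF assms(1)])
    show "P (Transposition.transpose L1 Lz)"
      unfolding P_def using gen by (auto intro!: graphical_function_swap_1z[OF assms(1)])
  qed
  then show "graphical_function T \<Gamma> z = graphical_function T (relabel \<sigma> \<Gamma>) (\<phi> \<sigma> z)"
    using z assms(2) unfolding P_def by blast
qed

end
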